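(* For every integer $n\geq 1$, $$\int_{0}^{1}\frac{\operatorname{Im}\!\left(\operatorname{Li}_{-2n}(ix)\right)}{x}\,\ln\!\left(\ln\frac{1}{x}\right)dx=(-1)^{n-1}2^{2n-1}(2n-1)!\,\frac{\beta(2n)}{\pi^{2n-1}},$$ and $$\int_{0}^{1}\frac{\operatorname{Li}_{-2n-1}(-x^{2})}{x}\,\ln\!\left(\ln\frac{1}{x}\right)dx=(-1)^n\,\frac{(2^{2n+1}-1)(2n)!}{2^{2n+2}}\,\frac{\zeta(2n+1)}{\pi^{2n}}.$$
   Context: $\operatorname{Li}_{s}(z)=\sum_{r\ge1} z^r r^{-s}$ ($|z|<1$) is the polylogarithm (for negative integer $s$ it is a rational function of $z$). $\zeta$ is the Riemann zeta function and $\beta$ is the Dirichlet beta function, $\beta(s)=\sum_{r\ge0}(-1)^r(2r+1)^{-s}$. *)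

theory Defs
  imports "HOL-Analysis.Analysis"
begin

text \<open>The defining series converges for \<open>norm z < 1\<close> and every \<open>s\<close>; outside the unit disc
  the value carries no meaning (no analytic continuation in \<open>z\<close> is attempted).\<close>

definition polylog :: "complex \<Rightarrow> complex \<Rightarrow> complex" where
  "polylog s z = (\<Sum>r. z ^ Suc r * of_nat (Suc r) powr (- s))"

text \<open>The Dirichlet series, which represents the Riemann zeta function for \<open>Re s > 1\<close> only.\<close>

definition riemann_zeta :: "complex \<Rightarrow> complex" where
  "riemann_zeta s = (\<Sum>r. of_nat (Suc r) powr (- s))"

text \<open>The series converges (conditionally if \<open>Re s \<le> 1\<close>) for \<open>Re s > 0\<close>.\<close>

definition dirichlet_beta :: "complex \<Rightarrow> complex" where
  "dirichlet_beta s = (\<Sum>r. (-1) ^ r * of_nat (2 * r + 1) powr (- s))"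

end

theory Submission
  imports Defs
begin

text \<open>
  Substituting \<open>x = exp (- t)\<close> turns both integrals into integrals of
  \<open>ln t * polylog (- m) (exp (- (p * t - \<i> * \<theta>)))\<close> over \<open>t > 0\<close>. The series of the polylogarithm
  cannot be integrated termwise near \<open>t = 0\<close>; but Lipschitz's summation formula (the \<open>m\<close>-fold
  derivative of the partial fraction expansion of the cotangent, obtained here by differentiating
  the reflection formula of the Digamma function) expands it as
  \<open>fact m * (\<Sum>k\<in>\<int>. (p * t - \<i> * (\<theta> + 2 * pi * k)) powi (- (m + 1)))\<close>, which can. Each term
  contributes an elementary integral of \<open>ln t * (t + c) powi (- (m + 1))\<close> with \<open>c\<close> on the imaginary
  axis; it contains \<open>Ln c\<close>, and only the part \<open>\<plusminus>\<i> * pi / 2\<close> of that logarithm survives in the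
  imaginary part for \<open>m = 2 * n\<close>, \<open>\<theta> = pi / 2\<close>, \<open>p = 1\<close>, respectively in the sum over \<open>k\<close> for
  \<open>m = 2 * n + 1\<close>, \<open>\<theta> = pi\<close>, \<open>p = 2\<close>. What remains is the Dirichlet series of \<open>\<beta>\<close>
  and the odd part of that of \<open>\<zeta>\<close>.
\<close>

section \<open>Polylogarithms of integer order at most 0\<close>

lemma polylog_neg_nat: "polylog (- of_nat m) z = (\<Sum>r. of_nat (Suc r) ^ m * z ^ Suc r)"
  unfolding polylog_def minus_minus
  by (subst powr_complexpow) (simp_all add: mult.commute del: of_nat_Suc)

text \<open>Termwise differentiation of a power series raises the exponent \<open>m\<close> by one
  and preserves convergence inside the disc. The induction keeps \<open>q\<close> arbitrary because
  differentiating at one point requires convergence on the whole unit disc.\<close>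

lemma summable_Suc_power_times_power:
  fixes q :: "'a :: {real_normed_field, banach}"
  assumes "norm q < 1"
  shows "summable (\<lambda>n. of_nat (Suc n) ^ m * q ^ n)"
  using assms
proof (induction m arbitrary: q)
  case 0
  thus ?case by simp
next
  case (Suc m)
  \<comment> \<open>The coefficient at 0 is set by hand, since \<open>0 ^ m\<close> would be 1 for
    \<open>m = 0\<close>.\<close>
  define c :: "nat \<Rightarrow> 'a" where "c = (\<lambda>n. if n = 0 then 0 else of_nat n ^ m)"
  have "summable (\<lambda>n. c n * x ^ n)" if "norm x < 1" for x
  proof -
    have "summable (\<lambda>n. (of_nat (Suc n) ^ m * x ^ n) * x)"
      by (intro summable_mult2 Suc.IH that)
    hence "summable (\<lambda>n. c (Suc n) * x ^ Suc n)"
      by (simp add: c_def mult_ac)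
    thus ?thesis by (subst (asm) summable_Suc_iff)
  qed
  hence "summable (\<lambda>n. diffs c n * q ^ n)"
    using Suc.prems by (rule termdiff_converges[rotated]) auto
  thus ?case by (simp add: diffs_def c_def)
qed

lemma polylog_neg_nat_sums:
  assumes "norm z < 1"
  shows "(\<lambda>r. of_nat (Suc r) ^ m * z ^ Suc r) sums polylog (- of_nat m) z"
proof -
  have "summable (\<lambda>r. (of_nat (Suc r) ^ m * z ^ r) * z)"
    by (intro summable_mult2 summable_Suc_power_times_power assms)
  thus ?thesis unfolding polylog_neg_nat by (simp add: mult_ac summable_sums)
qed

text \<open>In terms of \<open>z = exp u\<close>, differentiation in \<open>u\<close> is the
  operator \<open>z * d/dz\<close>. It multiplies the coefficient of \<open>z ^ r\<close> by
  \<open>r\<close> and thus lowers the order by one.\<close>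

lemma has_field_derivative_polylog_neg_nat_exp:
  assumes "Re u < 0"
  shows "((\<lambda>u. polylog (- of_nat m) (exp u)) has_field_derivative
           polylog (- of_nat (Suc m)) (exp u)) (at u)"
proof -
  define c :: "nat \<Rightarrow> complex" where "c = (\<lambda>n. if n = 0 then 0 else of_nat n ^ m)"
  have sums: "(\<lambda>n. c n * z ^ n) sums polylog (- of_nat m) z" if "norm z < 1" for z
  proof -
    have "(\<lambda>n. c (Suc n) * z ^ Suc n) sums polylog (- of_nat m) z"
      using polylog_neg_nat_sums[OF that, of m] by (simp add: c_def)
    thus ?thesis by (subst (asm) sums_Suc_iff) (simp add: c_def)
  qed
  have norm: "norm (exp u) < 1" using assms by simp
  have D: "((\<lambda>z. \<Sum>n. c n * z ^ n) has_field_derivative (\<Sum>n. diffs c n * exp u ^ n)) (at (exp u))"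
    by (rule termdiffs_strong'[of 1]) (use sums norm in \<open>auto simp: sums_iff\<close>)
  have eq: "(\<Sum>n. c n * z ^ n) = polylog (- of_nat m) z" if "z \<in> ball 0 1" for z
    using sums[of z] that by (auto simp: sums_iff)
  have "(polylog (- of_nat m) has_field_derivative (\<Sum>n. diffs c n * exp u ^ n)) (at (exp u))"
    by (rule has_field_derivative_transform_within_open[where S = "ball 0 1", OF D])
       (use norm eq in auto)
  from DERIV_chain2[OF this DERIV_exp]
  have "((\<lambda>u. polylog (- of_nat m) (exp u)) has_field_derivative
          (\<Sum>n. diffs c n * exp u ^ n) * exp u) (at u)" .
  also have "(\<Sum>n. diffs c n * exp u ^ n) * exp u = polylog (- of_nat (Suc m)) (exp u)"
  proof -
    have "(\<lambda>n. of_nat (Suc n) ^ Suc m * exp u ^ n) sums (\<Sum>n. diffs c n * exp u ^ n)"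
      using summable_Suc_power_times_power[OF norm, of "Suc m"]
      by (simp add: diffs_def c_def summable_sums)
    from sums_mult2[OF this, of "exp u"] polylog_neg_nat_sums[OF norm, of "Suc m"]
    show ?thesis by (simp add: sums_iff mult_ac)
  qed
  finally show ?thesis .
qed

section \<open>From the reflection formula to Lipschitz's summation formula\<close>

text \<open>Logarithmic differentiation of the reflection formula for Gamma. It is carried out with
  the entire function \<open>rGamma\<close>, whose product is nonzero at \<open>z\<close> because
  neither \<open>z\<close> nor \<open>1 - z\<close> is a pole of Gamma.\<close>

lemma Digamma_reflection:
  fixes z :: complex
  assumes "z \<notin> \<int>"
  shows "Digamma (1 - z) - Digamma z = of_real pi * cot (of_real pi * z)"
proof -
  have "1 - z \<notin> \<int>" using assms Ints_diff[OF Ints_1, of "1 - z"] by auto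
  hence z: "z \<notin> \<int>\<^sub>\<le>\<^sub>0" "1 - z \<notin> \<int>\<^sub>\<le>\<^sub>0"
    using assms nonpos_Ints_subset_Ints by blast+
  have eq: "rGamma z * rGamma (1 - z) = sin (of_real pi * z) / of_real pi" for z :: complex
    by (rule rGamma_reflection_complex)
  have "((\<lambda>z. rGamma z * rGamma (1 - z)) has_field_derivative
          rGamma z * rGamma (1 - z) * (Digamma (1 - z) - Digamma z)) (at z)"
    using z by (auto intro!: derivative_eq_intros simp: algebra_simps)
  moreover have "((\<lambda>z. rGamma z * rGamma (1 - z)) has_field_derivative cos (of_real pi * z)) (at z)"
    unfolding eq by (auto intro!: derivative_eq_intros)
  ultimately have "rGamma z * rGamma (1 - z) * (Digamma (1 - z) - Digamma z) = cos (of_real pi * z)"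
    by (rule DERIV_unique)
  moreover have "rGamma z * rGamma (1 - z) \<noteq> 0"
    using z by (simp add: rGamma_eq_zero_iff)
  ultimately show ?thesis unfolding eq by (simp add: cot_def field_simps)
qed

text \<open>For \<open>m = 0\<close>, the cotangent is a geometric series in
  \<open>exp (2 * pi * \<i> * z)\<close>, which has modulus below 1 as \<open>Im z > 0\<close>. Each
  differentiation then contributes a factor \<open>2 * pi * \<i>\<close> by the chain rule; the
  first one removes the constant \<open>1 / 2\<close>.\<close>

lemma Polygamma_reflection_polylog:
  assumes "Im z > 0"
  shows "Polygamma m z - (-1) ^ m * Polygamma m (1 - z) =
           (2 * of_real pi * \<i>) ^ Suc m *
             (polylog (- of_nat m) (exp (2 * of_real pi * \<i> * z)) + (if m = 0 then 1 / 2 else 0))"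
  using assms
proof (induction m arbitrary: z)
  case 0
  define q where "q = exp (2 * of_real pi * \<i> * z)"
  \<comment> \<open>A square root of \<open>q\<close>: sine and cosine of \<open>pi * z\<close> are
    rational in \<open>w\<close>, and their quotient is rational in \<open>w * w\<close>.\<close>
  define w where "w = exp (\<i> * (of_real pi * z))"
  have q: "norm q < 1" using 0 by (simp add: q_def)
  have "(\<lambda>r. q * q ^ r) sums (q * (1 / (1 - q)))"
    by (intro sums_mult geometric_sums q)
  hence L: "polylog 0 q = q / (1 - q)"
    using polylog_neg_nat_sums[OF q, of 0] by (simp add: sums_iff)
  have ww: "w * w = q" "w \<noteq> 0" by (simp_all add: w_def q_def mult_ac flip: exp_add)
  have "q \<noteq> 1" using q by auto
  have "sin (of_real pi * z) = (w - inverse w) / (2 * \<i>)" "cos (of_real pi * z) = (w + inverse w) / 2"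
    by (simp_all add: sin_exp_eq cos_exp_eq w_def exp_minus)
  moreover have "(a / 2) / (b / (2 * \<i>)) = \<i> * a / b" for a b :: complex
    by (cases "b = 0") (simp_all add: field_simps)
  ultimately have "cot (of_real pi * z) = \<i> * (w + inverse w) / (w - inverse w)"
    unfolding cot_def by simp
  also have "\<dots> = \<i> * ((w + inverse w) * w) / ((w - inverse w) * w)"
    using ww by simp
  also have "\<dots> = \<i> * (q + 1) / (q - 1)"
    using ww by (simp add: ring_distribs)
  finally have "cot (of_real pi * z) = \<i> * (q + 1) / (q - 1)" .
  moreover have "z \<notin> \<int>" using 0 by (auto elim!: Ints_cases)
  ultimately have "Digamma (1 - z) - Digamma z = of_real pi * \<i> * (q + 1) / (q - 1)"
    using Digamma_reflection by simp
  hence "Digamma z - Digamma (1 - z) = - (of_real pi * \<i> * (q + 1) / (q - 1))"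
    by (metis minus_diff_eq)
  also have "\<dots> = 2 * of_real pi * \<i> * (q / (1 - q) + 1 / 2)"
    using \<open>q \<noteq> 1\<close> by (simp add: divide_simps) (simp add: algebra_simps)
  finally show ?case unfolding q_def [symmetric] by (simp add: L)
next
  case (Suc m)
  let ?q = "\<lambda>z. exp (2 * of_real pi * \<i> * z)"
  have nonpos: "z \<notin> \<int>\<^sub>\<le>\<^sub>0" "1 - z \<notin> \<int>\<^sub>\<le>\<^sub>0"
    using Suc.prems by (auto elim!: nonpos_Ints_cases simp: complex_eq_iff)
  have "((\<lambda>z. Polygamma m z - (-1) ^ m * Polygamma m (1 - z)) has_field_derivative
          Polygamma (Suc m) z - (-1) ^ Suc m * Polygamma (Suc m) (1 - z)) (at z)"
    using nonpos by (auto intro!: derivative_eq_intros)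
  \<comment> \<open>The induction hypothesis holds on the whole open half-plane, so its right-hand
    side has the derivative just found for its left-hand side.\<close>
  hence "((\<lambda>z. (2 * of_real pi * \<i>) ^ Suc m * (polylog (- of_nat m) (?q z) + (if m = 0 then 1 / 2 else 0)))
           has_field_derivative Polygamma (Suc m) z - (-1) ^ Suc m * Polygamma (Suc m) (1 - z)) (at z)"
    by (rule has_field_derivative_transform_within_open[where S = "{z. Im z > 0}"])
       (use Suc in \<open>auto simp: open_halfspace_Im_gt\<close>)
  moreover have "((\<lambda>z. polylog (- of_nat m) (?q z)) has_field_derivative
          polylog (- of_nat (Suc m)) (?q z) * (2 * of_real pi * \<i> * 1)) (at z)"
    by (intro DERIV_chain2[OF has_field_derivative_polylog_neg_nat_exp] DERIV_cmult DERIV_ident)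
       (use Suc.prems in auto)
  hence "((\<lambda>z. (2 * of_real pi * \<i>) ^ Suc m * (polylog (- of_nat m) (?q z) + (if m = 0 then 1 / 2 else 0)))
           has_field_derivative (2 * of_real pi * \<i>) ^ Suc m *
             (polylog (- of_nat (Suc m)) (?q z) * (2 * of_real pi * \<i> * 1) + 0)) (at z)"
    by (intro DERIV_cmult DERIV_add DERIV_const)
  ultimately have "Polygamma (Suc m) z - (-1) ^ Suc m * Polygamma (Suc m) (1 - z) =
      (2 * of_real pi * \<i>) ^ Suc m * (polylog (- of_nat (Suc m)) (?q z) * (2 * of_real pi * \<i> * 1) + 0)"
    by (rule DERIV_unique)
  thus ?case
    by (simp add: mult_ac del: of_nat_Suc)
qed

text \<open>The two summands are the terms with index \<open>k\<close> and \<open>- k - 1\<close> of the sum over all integers.\<close>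

theorem lipschitz_summation:
  assumes "m \<ge> 1" "Re u > 0"
  shows "(\<lambda>k. inverse ((u - 2 * of_real pi * \<i> * of_nat k) ^ Suc m) +
              inverse ((u + 2 * of_real pi * \<i> * of_nat (Suc k)) ^ Suc m))
          sums (polylog (- of_nat m) (exp (- u)) / fact m)"
proof -
  \<comment> \<open>Chosen so that \<open>exp (2 * pi * \<i> * z) = exp (- u)\<close>; then
    \<open>Re u > 0\<close> becomes \<open>Im z > 0\<close>.\<close>
  define z where "z = \<i> * u / (2 * of_real pi)"
  have z: "Im z > 0" using assms by (simp add: z_def)
  have u: "u = - 2 * of_real pi * \<i> * z" by (simp add: z_def)
  define C where "C = 2 * of_real pi * \<i>"
  have "z \<noteq> 0" "1 - z \<noteq> 0" using z by auto
  \<comment> \<open>The series of the Polygamma function at \<open>z\<close> and at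
    \<open>1 - z\<close>, weighted so that the values combine to the left-hand side of the
    reflection formula. The terms match because \<open>u - C * k = - C * (z + k)\<close> and
    \<open>u + C * (k + 1) = C * (1 - z + k)\<close>.\<close>
  hence "(\<lambda>k. (-1) ^ Suc m / C ^ Suc m * inverse ((z + of_nat k) ^ Suc m) +
          1 / C ^ Suc m * inverse ((1 - z + of_nat k) ^ Suc m)) sums
     ((-1) ^ Suc m / C ^ Suc m * ((-1) ^ Suc m * Polygamma m z / fact m) +
      1 / C ^ Suc m * ((-1) ^ Suc m * Polygamma m (1 - z) / fact m))"
    by (intro sums_add sums_mult Polygamma_LIMSEQ) (use assms in auto)
  also have "(\<lambda>k. (-1) ^ Suc m / C ^ Suc m * inverse ((z + of_nat k) ^ Suc m) +
          1 / C ^ Suc m * inverse ((1 - z + of_nat k) ^ Suc m)) =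
       (\<lambda>k. inverse ((u - C * of_nat k) ^ Suc m) + inverse ((u + C * of_nat (Suc k)) ^ Suc m))"
  proof
    fix k
    have "inverse ((u - C * of_nat k) ^ Suc m) = inverse (((-1) * C * (z + of_nat k)) ^ Suc m)"
      by (simp add: u C_def algebra_simps)
    also have "\<dots> = (-1) ^ Suc m / C ^ Suc m * inverse ((z + of_nat k) ^ Suc m)"
      unfolding power_mult_distrib inverse_mult_distrib
      by (cases "even m") (simp_all add: divide_inverse)
    finally have 1: "inverse ((u - C * of_nat k) ^ Suc m) = \<dots>" .
    have "inverse ((u + C * of_nat (Suc k)) ^ Suc m) = inverse ((C * (1 - z + of_nat k)) ^ Suc m)"
      by (simp add: u C_def algebra_simps)
    also have "\<dots> = 1 / C ^ Suc m * inverse ((1 - z + of_nat k) ^ Suc m)"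
      unfolding power_mult_distrib inverse_mult_distrib by (simp add: divide_inverse)
    finally have 2: "inverse ((u + C * of_nat (Suc k)) ^ Suc m) = \<dots>" .
    show "(-1) ^ Suc m / C ^ Suc m * inverse ((z + of_nat k) ^ Suc m) +
          1 / C ^ Suc m * inverse ((1 - z + of_nat k) ^ Suc m) =
       inverse ((u - C * of_nat k) ^ Suc m) + inverse ((u + C * of_nat (Suc k)) ^ Suc m)"
      unfolding 1 2 ..
  qed
  also have "(-1) ^ Suc m / C ^ Suc m * ((-1) ^ Suc m * Polygamma m z / fact m) +
      1 / C ^ Suc m * ((-1) ^ Suc m * Polygamma m (1 - z) / fact m) =
       (Polygamma m z - (-1) ^ m * Polygamma m (1 - z)) / C ^ Suc m / fact m"
    by (cases "even m") (simp_all add: add_divide_distrib diff_divide_distrib)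
  also have "(Polygamma m z - (-1) ^ m * Polygamma m (1 - z)) / C ^ Suc m =
               polylog (- of_nat m) (exp (- u))"
  proof -
    have "C \<noteq> 0" by (simp add: C_def)
    have "2 * of_real pi * \<i> * z = - u" by (simp add: u)
    with Polygamma_reflection_polylog[OF z, of m] assms \<open>C \<noteq> 0\<close> show ?thesis
      unfolding C_def by simp
  qed
  finally show ?thesis unfolding C_def .
qed

section \<open>An integrable majorant for the terms\<close>

text \<open>Dominates \<open>\<bar>ln t\<bar> * max 1 t powr (-3/2)\<close>. The logarithm is
  absorbed by a quarter power through \<open>ln x \<le> x powr a / a\<close> with
  \<open>a = 1/4\<close>, which explains the factor 4; the resulting exponents lie on the integrable
  side of -1 at 0 and at infinity.\<close>

definition ln_majorant :: "real \<Rightarrow> real" where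
  "ln_majorant t = 4 * (if t \<le> 1 then t powr (-1/4) else t powr (-5/4))"

lemma ln_majorant_integrable: "ln_majorant integrable_on {0<..}"
proof -
  have "(\<lambda>t. 4 * t powr (-1/4)) integrable_on {0<..1::real}"
    using integrable_on_cmult_left[OF integrable_on_powr_from_0'[of "-1/4" 1], of 4] by simp
  hence "ln_majorant integrable_on {0<..1}"
    by (rule integrable_eq) (simp add: ln_majorant_def)
  moreover have "(\<lambda>t. t powr (-5/4)) integrable_on {1::real..}"
    by (rule has_integral_integrable[OF has_integral_powr_to_inf]) auto
  hence "(\<lambda>t. 4 * t powr (-5/4)) integrable_on {1::real..}"
    using integrable_on_cmult_left[of "\<lambda>t. t powr (-5/4)" "{1..}" 4] by simp
  hence "ln_majorant integrable_on {1..}"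
    by (rule integrable_eq) (auto simp: ln_majorant_def)
  moreover have "{0<..1} \<inter> {1..} = {1::real}" "{0<..1} \<union> {1..} = {0::real<..}" by auto
  ultimately show ?thesis
    using integrable_Un[of "{0<..1}" "{1..}" ln_majorant] by simp
qed

lemma abs_ln_le_ln_majorant:
  assumes "t > 0"
  shows "\<bar>ln t\<bar> * max 1 t powr (-3/2) \<le> ln_majorant t"
proof (cases "t \<le> 1")
  case True
  have "\<bar>ln t\<bar> = ln (1 / t)" using True assms by (simp add: ln_div)
  also have "\<dots> \<le> (1 / t) powr (1/4) / (1/4)"
    by (intro ln_powr_bound) (use True assms in auto)
  also have "\<dots> = 4 * t powr (-1/4)"
    using assms by (simp add: powr_divide powr_minus field_simps)
  finally show ?thesis using True by (simp add: ln_majorant_def)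
next
  case False
  have "ln t * t powr (-3/2) \<le> (t powr (1/4) / (1/4)) * t powr (-3/2)"
    by (intro mult_right_mono ln_powr_bound) (use False in auto)
  also have "\<dots> = 4 * t powr (-5/4)"
    using assms by (simp flip: powr_add)
  finally show ?thesis using False by (simp add: ln_majorant_def)
qed

text \<open>Shares the decay between two lower bounds: of three powers of \<open>x / d\<close>, half
  go to \<open>a\<close> and half to \<open>b\<close>. The exponent \<open>3/2\<close> exceeds 1, so
  one half can serve a sum over \<open>k\<close> and the other an integral over
  \<open>t\<close>.\<close>

lemma inverse_power_le_powr:
  fixes x d a b :: real
  assumes "d > 0" "a \<ge> 1" "b \<ge> 1" "d * a \<le> x" "d * b \<le> x" "N \<ge> 3"
  shows "inverse (x ^ N) \<le> a powr (-3/2) * b powr (-3/2) / d ^ N"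
proof -
  define y where "y = x / d"
  have y: "y \<ge> a" "y \<ge> b" using assms by (simp_all add: y_def field_simps)
  have "a powr (3/2) * b powr (3/2) \<le> y powr (3/2) * y powr (3/2)"
    by (intro mult_mono powr_mono2) (use y assms in auto)
  also have "\<dots> = y ^ 3"
    using y assms by (simp flip: powr_add)
  also have "\<dots> \<le> y ^ N"
    by (intro power_increasing) (use y assms in auto)
  finally have "inverse (y ^ N) \<le> inverse (a powr (3/2) * b powr (3/2))"
    by (intro le_imp_inverse_le) (use assms in auto)
  moreover have "inverse (x ^ N) = inverse (y ^ N) / d ^ N"
    using assms by (simp add: y_def power_divide inverse_eq_divide)
  ultimately show ?thesis using assms
    by (simp add: powr_minus divide_right_mono)
qed

lemma norm_of_real_add_ge:
  assumes "t \<ge> 0" "Re c \<ge> 0"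
  shows "t \<le> norm (of_real t + c)" "norm c \<le> norm (of_real t + c)"
proof -
  have "t \<le> Re (of_real t + c)" using assms by simp
  also have "\<dots> \<le> norm (of_real t + c)" by (rule complex_Re_le_cmod)
  finally show "t \<le> norm (of_real t + c)" .
  show "norm c \<le> norm (of_real t + c)"
    unfolding cmod_def using assms by (intro real_sqrt_le_mono add_mono) (simp_all add: power_mono)
qed

text \<open>With \<open>a = Suc k\<close> this is a bound summable in \<open>k\<close>; with
  \<open>a = 1\<close> it dominates a single integrand. The condition \<open>d \<le> 1\<close>
  allows \<open>t\<close> itself to serve as the second lower bound, through
  \<open>b = max 1 t\<close>.\<close>

lemma norm_ln_inverse_power_le:
  assumes "t > 0" "Re c \<ge> 0" "0 < d" "d \<le> 1" "1 \<le> a" "d * a \<le> norm c" "N \<ge> 3"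
  shows "norm (of_real (ln t) * inverse ((of_real t + c) ^ N)) \<le>
           a powr (-3/2) / d ^ N * ln_majorant t"
proof -
  let ?x = "norm (of_real t + c)"
  have x: "t \<le> ?x" "norm c \<le> ?x" using assms norm_of_real_add_ge by auto
  have "d * 1 \<le> d * a" "d * t \<le> 1 * t"
    using assms by (auto intro!: mult_left_mono mult_right_mono)
  hence "d * a \<le> ?x" "d * t \<le> ?x" "d * 1 \<le> ?x" using x assms by linarith+
  hence le: "d * a \<le> ?x" "d * max 1 t \<le> ?x" by (auto simp: max_def)
  have "norm (of_real (ln t) * inverse ((of_real t + c) ^ N)) = \<bar>ln t\<bar> * inverse (?x ^ N)"
    by (simp add: norm_mult norm_inverse norm_power)
  also have "\<dots> \<le> \<bar>ln t\<bar> * (a powr (-3/2) * max 1 t powr (-3/2) / d ^ N)"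
    by (intro mult_left_mono inverse_power_le_powr le) (use assms in auto)
  also have "\<dots> = a powr (-3/2) / d ^ N * (\<bar>ln t\<bar> * max 1 t powr (-3/2))"
    by simp
  also have "\<dots> \<le> a powr (-3/2) / d ^ N * ln_majorant t"
    by (intro mult_left_mono abs_ln_le_ln_majorant) (use assms in auto)
  finally show ?thesis .
qed

section \<open>The integral of one term\<close>

text \<open>The antiderivative \<open>F\<close> comes from integration by parts and the partial
  fractions of \<open>1 / (t * (t + c) ^ m)\<close>, written in \<open>w = c / (t + c)\<close>. It
  vanishes at infinity, and its limit at 0 yields the value. The improper integral is reached by
  dominated convergence from compact intervals.\<close>

lemma has_integral_ln_inverse_power:
  fixes c :: complex
  assumes c: "Re c \<ge> 0" "c \<noteq> 0" and m: "m \<ge> 2"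
  shows "((\<lambda>t. of_real (ln t) * inverse ((of_real t + c) ^ Suc m)) has_integral
           (Ln c - harm (m - 1)) / (of_nat m * c ^ m)) {0<..}"
proof -
  define f where "f = (\<lambda>t. of_real (ln t) * inverse ((of_real t + c) ^ Suc m))"
  define w where "w = (\<lambda>t::real. c / (of_real t + c))"
  define F where "F = (\<lambda>t. (of_real (ln t) * (1 - w t ^ m) - Ln (of_real t + c) +
                            (\<Sum>j=1..m-1. w t ^ j / of_nat j)) / (of_nat m * c ^ m))"
  define d where "d = min 1 (norm c)"
  have d: "0 < d" "d \<le> 1" "d * 1 \<le> norm c" using c by (auto simp: d_def)
  have nz: "of_real t + c \<noteq> 0" "of_real t + c \<notin> \<real>\<^sub>\<le>\<^sub>0" if "t > 0" for t
    using c that by (auto simp: complex_eq_iff complex_nonpos_Reals_iff)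
  have geom: "(1 - w t) * (\<Sum>j<m. w t ^ j) = 1 - w t ^ m" for t
    by (simp add: one_diff_power_eq)
  have one_minus_w: "1 - w t = of_real t / (of_real t + c)" if "t > 0" for t
    using nz[OF that] by (simp add: w_def field_simps)
  have deriv: "(F has_vector_derivative f t) (at t within A)" if "t > 0" for t A
  proof -
    \<comment> \<open>\<open>W\<close> and \<open>G\<close> extend \<open>w\<close> and
      \<open>F\<close> to complex arguments, where the rules for complex derivatives apply.\<close>
    define W where "W = (\<lambda>z::complex. c / (z + c))"
    define G where "G = (\<lambda>z::complex. (Ln z * (1 - W z ^ m) - Ln (z + c) +
                            (\<Sum>j=1..m-1. W z ^ j / of_nat j)) / (of_nat m * c ^ m))"
    define z where "z = complex_of_real t"
    define S where "S = (\<Sum>j<m. W z ^ j)"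
    have z: "z \<notin> \<real>\<^sub>\<le>\<^sub>0" "z + c \<notin> \<real>\<^sub>\<le>\<^sub>0" "z + c \<noteq> 0" "z \<noteq> 0"
      using nz[OF that] that by (auto simp: z_def complex_nonpos_Reals_iff)
    have dW: "(W has_field_derivative - W z / (z + c)) (at z)"
      unfolding W_def using z by (auto intro!: derivative_eq_intros simp: field_simps)
    have dpow: "((\<lambda>z. W z ^ j) has_field_derivative - (of_nat j * W z ^ j / (z + c))) (at z)" for j
      using DERIV_power[OF dW, of j] by (cases j) (simp_all add: mult_ac)
    have "(G has_field_derivative
            (inverse z * (1 - W z ^ m) + (0 - - (of_nat m * W z ^ m / (z + c))) * Ln z
             - inverse (z + c) * (1 + 0) +
             (\<Sum>j=1..m-1. - (of_nat j * W z ^ j / (z + c)) / of_nat j)) / (of_nat m * c ^ m)) (at z)"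
      unfolding G_def
      by (intro DERIV_cdivide DERIV_add DERIV_diff DERIV_mult DERIV_sum DERIV_const DERIV_ident dpow
            DERIV_chain2[OF has_field_derivative_Ln] has_field_derivative_Ln z)
    also have "(\<Sum>j=1..m-1. - (of_nat j * W z ^ j / (z + c)) / of_nat j) =
                 - (\<Sum>j=1..m-1. W z ^ j) / (z + c)"
      unfolding sum_divide_distrib sum_negf [symmetric] by (intro sum.cong) auto
    also have "(\<Sum>j=1..m-1. W z ^ j) = S - 1"
    proof -
      have "{..<m} = insert 0 {1..m-1}" using m by auto
      thus ?thesis by (simp add: S_def)
    qed
    also have "inverse z * (1 - W z ^ m) = S / (z + c)"
    proof -
      have "1 - W z ^ m = z / (z + c) * S"
        using geom[of t] one_minus_w[OF that] by (simp add: w_def z_def W_def S_def)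
      thus ?thesis using z by simp
    qed
    also have "(S / (z + c) + (0 - - (of_nat m * W z ^ m / (z + c))) * Ln z -
                 inverse (z + c) * (1 + 0) + - (S - 1) / (z + c)) / (of_nat m * c ^ m) =
               Ln z * W z ^ m / (z + c) / c ^ m"
      using m c z by (simp add: divide_simps)
    also have "\<dots> = f t"
      using that z c by (simp add: f_def z_def W_def Ln_of_real power_divide divide_simps)
    finally have "((\<lambda>t. G (of_real t)) has_vector_derivative f t) (at t)"
      unfolding z_def by (rule has_vector_derivative_real_field)
    hence "(F has_vector_derivative f t) (at t)"
      by (rule has_vector_derivative_transform_within_open[where S = "{0<..}"])
         (use that in \<open>auto simp: F_def G_def W_def w_def Ln_of_real\<close>)
    thus ?thesis by (rule has_vector_derivative_at_within)
  qed
  have c': "c \<notin> \<real>\<^sub>\<le>\<^sub>0"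
    using c by (auto simp: complex_nonpos_Reals_iff complex_eq_iff)
  have t0: "((\<lambda>t. of_real t + c) \<longlongrightarrow> of_real 0 + c) (at_right 0)"
    by (intro tendsto_intros)
  have Ln0: "((\<lambda>t. Ln (of_real t + c)) \<longlongrightarrow> Ln c) (at_right 0)"
    using tendsto_Ln[OF t0] c' by simp
  have w0: "(w \<longlongrightarrow> 1) (at_right 0)"
    using tendsto_divide[OF tendsto_const t0, of c] c by (simp add: w_def)
  \<comment> \<open>The limit of \<open>t * ln t\<close> at 0, read off from \<open>ln x / x\<close>
    at infinity. Since \<open>1 - w t ^ m\<close> contains the factor \<open>t / (t + c)\<close>, it
    removes the logarithmic singularity of \<open>F\<close>.\<close>
  have "((\<lambda>t::real. - (ln (inverse t) / inverse t)) \<longlongrightarrow> - 0) (at_right 0)"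
    by (intro tendsto_minus filterlim_compose[OF ln_x_over_x_tendsto_0 filterlim_inverse_at_top_right])
  also have "?this \<longleftrightarrow> ((\<lambda>t::real. ln t * t) \<longlongrightarrow> 0) (at_right 0)"
    by (intro filterlim_cong refl eventually_mono[OF eventually_at_right_less[of 0]])
       (simp_all add: ln_inverse divide_inverse)
  finally have "((\<lambda>t. of_real (ln t * t) / (of_real t + c) * (\<Sum>j<m. w t ^ j)) \<longlongrightarrow>
                  of_real 0 / (of_real 0 + c) * (\<Sum>j<m. 1 ^ j)) (at_right 0)"
    by (intro tendsto_intros w0) (use c in auto)
  also have "?this \<longleftrightarrow> ((\<lambda>t. of_real (ln t) * (1 - w t ^ m)) \<longlongrightarrow>
                          of_real 0 / (of_real 0 + c) * (\<Sum>j<m. 1 ^ j)) (at_right 0)"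
    by (intro filterlim_cong refl eventually_mono[OF eventually_at_right_less[of 0]])
       (simp add: one_minus_w flip: geom)
  finally have lim0: "((\<lambda>t. of_real (ln t) * (1 - w t ^ m)) \<longlongrightarrow> 0) (at_right 0)"
    by simp
  have F0: "(F \<longlongrightarrow> (0 - Ln c + (\<Sum>j=1..m-1. 1 ^ j / of_nat j)) / (of_nat m * c ^ m)) (at_right 0)"
    unfolding F_def by (intro tendsto_intros lim0 w0 Ln0) (use c m in auto)
  have inf: "filterlim complex_of_real at_infinity at_top"
    by (rule filterlim_of_real_at_infinity)
  have winf: "(w \<longlongrightarrow> 0) at_top"
    unfolding w_def
    by (intro tendsto_divide_0[OF tendsto_const] tendsto_add_filterlim_at_infinity'[OF inf tendsto_const])
  \<comment> \<open>As \<open>w t = c * (1 - w t) / t\<close>, one factor \<open>w t\<close>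
    supplies the \<open>1 / t\<close> that beats the logarithm.\<close>
  have "((\<lambda>t. of_real (ln t / t) * (c * (1 - w t)) * w t ^ (m - 1)) \<longlongrightarrow>
          of_real 0 * (c * (1 - 0)) * 0 ^ (m - 1)) at_top"
    by (intro tendsto_intros winf ln_x_over_x_tendsto_0)
  also have "?this \<longleftrightarrow> ((\<lambda>t. of_real (ln t) * w t ^ m) \<longlongrightarrow> of_real 0 * (c * (1 - 0)) * 0 ^ (m - 1)) at_top"
  proof (intro filterlim_cong refl eventually_mono[OF eventually_gt_at_top[of 0]])
    fix t :: real assume t: "t > 0"
    have "of_real (ln t / t) * (c * (1 - w t)) = of_real (ln t) * w t"
      unfolding one_minus_w[OF t] unfolding w_def using t by simp
    hence "of_real (ln t / t) * (c * (1 - w t)) * w t ^ (m - 1) =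
             of_real (ln t) * w t * w t ^ (m - 1)"
      by simp
    also have "\<dots> = of_real (ln t) * w t ^ m"
      using m power_minus_mult[of m "w t"] by (simp add: mult_ac)
    finally show "of_real (ln t / t) * (c * (1 - w t)) * w t ^ (m - 1) = of_real (ln t) * w t ^ m" .
  qed
  finally have liminf: "((\<lambda>t. of_real (ln t) * w t ^ m) \<longlongrightarrow> 0) at_top" by simp
  have "((\<lambda>t. - Ln (1 + c / of_real t)) \<longlongrightarrow> - Ln (1 + 0)) at_top"
    by (intro tendsto_intros tendsto_divide_0[OF tendsto_const] inf) auto
  also have "?this \<longleftrightarrow> ((\<lambda>t. of_real (ln t) - Ln (of_real t + c)) \<longlongrightarrow> - Ln (1 + 0)) at_top"
  proof (intro filterlim_cong refl eventually_mono[OF eventually_gt_at_top[of 0]])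
    fix t :: real assume t: "t > 0"
    have "of_real t + c = of_real t * (1 + c / of_real t)" using t by (simp add: field_simps)
    moreover have "1 + c / of_real t \<noteq> 0" using calculation nz[OF t] by auto
    ultimately have "Ln (of_real t + c) = of_real (ln t) + Ln (1 + c / of_real t)"
      using t by (simp add: Ln_times_of_real Ln_of_real)
    thus "- Ln (1 + c / of_real t) = of_real (ln t) - Ln (of_real t + c)" by simp
  qed
  finally have Lninf: "((\<lambda>t. of_real (ln t) - Ln (of_real t + c)) \<longlongrightarrow> 0) at_top" by simp
  \<comment> \<open>\<open>ln t\<close> and \<open>Ln (t + c)\<close> both diverge, so
    \<open>F\<close> is regrouped to use the limit of their difference.\<close>
  have "((\<lambda>t. ((of_real (ln t) - Ln (of_real t + c)) - of_real (ln t) * w t ^ m +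
           (\<Sum>j=1..m-1. w t ^ j / of_nat j)) / (of_nat m * c ^ m)) \<longlongrightarrow>
         (0 - 0 + (\<Sum>j=1..m-1. 0 ^ j / of_nat j)) / (of_nat m * c ^ m)) at_top"
    by (intro tendsto_intros liminf winf Lninf) (use c m in auto)
  also have "(\<Sum>j=1..m-1. 0 ^ j / of_nat j) = (0 :: complex)"
    by (intro sum.neutral) auto
  finally have Finf: "(F \<longlongrightarrow> 0) at_top"
    by (simp add: F_def algebra_simps)
  have Suc_at_top: "filterlim (\<lambda>k. real (Suc k)) at_top sequentially"
    by (rule filterlim_compose[OF filterlim_real_sequentially filterlim_Suc])
  \<comment> \<open>Integrals of \<open>f\<close> over the exhausting intervals from
    \<open>1 / (k + 1)\<close> to \<open>k + 1\<close>.\<close>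
  define y where "y = (\<lambda>k. F (real (Suc k)) - F (inverse (real (Suc k))))"
  have "(f has_integral (0 - (0 - Ln c + (\<Sum>j=1..m-1. 1 ^ j / of_nat j)) / (of_nat m * c ^ m))) {0<..}"
  proof (rule has_integral_dominated_convergence)
    let ?I = "\<lambda>k. {inverse (real (Suc k))..real (Suc k)}"
    fix k
    have "1 \<le> real (Suc k)" "inverse (real (Suc k)) \<le> 1" by (simp_all add: field_simps)
    hence le: "inverse (real (Suc k)) \<le> real (Suc k)" by linarith
    have pos: "t > 0" if "t \<in> ?I k" for t
      using that by (auto intro: less_le_trans[of 0 "inverse (real (Suc k))"])
    have "(f has_integral y k) (?I k)"
      unfolding y_def by (intro fundamental_theorem_of_calculus le deriv pos)
    thus "((\<lambda>t. if t \<in> ?I k then f t else 0) has_integral y k) {0<..}"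
      by (subst has_integral_restrict) (use pos in auto)
    show "\<forall>t\<in>{0<..}. norm (if t \<in> ?I k then f t else 0) \<le>
            1 powr (-3/2) / d ^ Suc m * ln_majorant t"
    proof
      fix t :: real assume "t \<in> {0<..}"
      hence "norm (f t) \<le> 1 powr (-3/2) / d ^ Suc m * ln_majorant t"
        unfolding f_def by (intro norm_ln_inverse_power_le) (use c d m in auto)
      thus "norm (if t \<in> ?I k then f t else 0) \<le> 1 powr (-3/2) / d ^ Suc m * ln_majorant t"
        by (rule order_trans[rotated]) simp
    qed
  next
    show "(\<lambda>t. 1 powr (-3/2) / d ^ Suc m * ln_majorant t) integrable_on {0<..}"
      by (intro integrable_on_mult_right ln_majorant_integrable)
  next
    show "\<forall>t\<in>{0<..}. (\<lambda>k. if t \<in> {inverse (real (Suc k))..real (Suc k)} then f t else 0) \<longlonglongrightarrow> f t"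
    proof
      fix t :: real assume t: "t \<in> {0<..}"
      have "eventually (\<lambda>k. t < real (Suc k)) sequentially"
           "eventually (\<lambda>k. inverse (real (Suc k)) < t) sequentially"
        using t filterlim_at_top_dense[of "\<lambda>k. real (Suc k)" sequentially] Suc_at_top
          order_tendstoD(2)[OF LIMSEQ_inverse_real_of_nat, of t] by auto
      hence "eventually (\<lambda>k. (if t \<in> {inverse (real (Suc k))..real (Suc k)} then f t else 0) = f t) sequentially"
        by eventually_elim auto
      thus "(\<lambda>k. if t \<in> {inverse (real (Suc k))..real (Suc k)} then f t else 0) \<longlonglongrightarrow> f t"
        by (rule tendsto_eventually)
    qed
  next
    show "y \<longlonglongrightarrow> 0 - (0 - Ln c + (\<Sum>j=1..m-1. 1 ^ j / of_nat j)) / (of_nat m * c ^ m)"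
      unfolding y_def
      by (intro tendsto_diff filterlim_compose[OF Finf Suc_at_top] filterlim_compose[OF F0]
            filterlim_compose[OF filterlim_inverse_at_right_top Suc_at_top])
  qed
  also have "0 - (0 - Ln c + (\<Sum>j=1..m-1. 1 ^ j / of_nat j)) / (of_nat m * c ^ m) =
               (Ln c - harm (m - 1)) / (of_nat m * c ^ m)"
    by (simp add: harm_def inverse_eq_divide diff_divide_distrib)
  finally show ?thesis unfolding f_def .
qed

section \<open>Termwise integration and the substitution\<close>

text \<open>\<open>c\<close> and \<open>c'\<close> together enumerate the numbers \<open>- \<i> * (\<theta> + 2 * pi * j) / p\<close> for \<open>j \<ge> 0\<close> and
  \<open>j < 0\<close>, so that the factors of Lipschitz's formula are \<open>p * (t + c k)\<close> and \<open>p * (t + c' k)\<close>.\<close>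

theorem polylog_ln_integral_Ioi:
  fixes \<theta> :: real and m p :: nat
  defines "c \<equiv> \<lambda>k. - \<i> * of_real ((\<theta> + 2 * pi * real k) / real p)"
      and "c' \<equiv> \<lambda>k. \<i> * of_real ((2 * pi * real (Suc k) - \<theta>) / real p)"
      and "J \<equiv> \<lambda>c. (Ln c - harm (m - 1)) / (of_nat m * c ^ m)"
      and "g \<equiv> \<lambda>t. of_real (ln t) * polylog (- of_nat m) (exp (- (of_nat p * of_real t - \<i> * of_real \<theta>)))"
  assumes \<theta>: "0 < \<theta>" "\<theta> < 2 * pi" and m: "m \<ge> 2" and p: "p > 0"
  shows "g absolutely_integrable_on {0<..}"
    and "(\<lambda>k. fact m / of_nat p ^ Suc m * (J (c k) + J (c' k))) sums integral {0<..} g"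
proof -
  \<comment> \<open>Makes \<open>d * (k + 1)\<close> a lower bound for the norms of
    \<open>c k\<close> and \<open>c' k\<close>: the terms with \<open>k = 0\<close> give
    \<open>d\<close>, and each further step adds \<open>2 * pi / p\<close>, which is at least
    \<open>d\<close>.\<close>
  define d where "d = min 1 (min (\<theta> / p) ((2 * pi - \<theta>) / p))"
  define h where "h = (\<lambda>k t. fact m / of_nat p ^ Suc m *
     (of_real (ln t) * inverse ((of_real t + c k) ^ Suc m) +
      of_real (ln t) * inverse ((of_real t + c' k) ^ Suc m)))"
  define C where "C = 2 * fact m / real p ^ Suc m / d ^ Suc m"
  define M where "M = (\<lambda>t. C * (\<Sum>k. real (Suc k) powr (-3/2)) * ln_majorant t)"
  have d: "0 < d" "d \<le> 1" "d \<le> \<theta> / p" "d \<le> (2 * pi - \<theta>) / p"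
    using \<theta> p by (auto simp: d_def)
  have "d \<le> 2 * pi / p" using d(3) \<theta> p by (simp add: field_simps)
  hence dk: "d * k \<le> 2 * pi * k / p" for k :: nat
    using mult_right_mono[of d "2 * pi / p" "real k"] by simp
  have c_norm: "norm (c k) = (\<theta> + 2 * pi * real k) / real p" for k
    unfolding c_def norm_mult norm_of_real using \<theta> p by simp
  have c'_norm: "norm (c' k) = (2 * pi * real (Suc k) - \<theta>) / real p" for k
  proof -
    have "2 * pi * 1 \<le> 2 * pi * real (Suc k)" by (intro mult_left_mono) auto
    hence "2 * pi * real (Suc k) - \<theta> \<ge> 0" using \<theta> by linarith
    thus ?thesis unfolding c'_def norm_mult norm_of_real by (simp del: of_nat_Suc)
  qed
  have c_ge: "d * real (Suc k) \<le> norm (c k)" "d * real (Suc k) \<le> norm (c' k)" for k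
    using d dk[of k] unfolding c_norm c'_norm
    by (simp_all add: algebra_simps add_divide_distrib diff_divide_distrib)
  have "d * real (Suc k) > 0" for k using d by simp
  hence c_nz: "c k \<noteq> 0" "c' k \<noteq> 0" for k
    using c_ge[of k] by (metis norm_zero not_less)+
  have c_Re: "Re (c k) = 0" "Re (c' k) = 0" for k by (simp_all add: c_def c'_def)
  have h_int: "(h k has_integral fact m / of_nat p ^ Suc m * (J (c k) + J (c' k))) {0<..}" for k
    unfolding h_def J_def
    by (intro has_integral_mult_right has_integral_add has_integral_ln_inverse_power)
       (use c_nz c_Re m in auto)
  have h_bound: "norm (h k t) \<le> C * real (Suc k) powr (-3/2) * ln_majorant t" if "t > 0" for k t
  proof -
    have "norm (h k t) \<le> fact m / real p ^ Suc m *
            (real (Suc k) powr (-3/2) / d ^ Suc m * ln_majorant t +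
             real (Suc k) powr (-3/2) / d ^ Suc m * ln_majorant t)"
      unfolding h_def norm_mult norm_divide norm_power norm_of_nat norm_fact
      unfolding norm_mult [symmetric]
      by (intro mult_left_mono order_trans[OF norm_triangle_ineq] add_mono norm_ln_inverse_power_le)
         (use that d c_ge c_Re m in auto)
    thus ?thesis by (simp add: C_def mult_ac)
  qed
  have summable: "summable (\<lambda>k. real (Suc k) powr (-3/2))"
    using summable_real_powr_iff[of "-3/2"] by (subst summable_Suc_iff) simp
  have M_int: "M integrable_on {0<..}"
    unfolding M_def by (intro integrable_on_mult_right ln_majorant_integrable)
  have majorant_nonneg: "ln_majorant t \<ge> 0" for t
    by (simp add: ln_majorant_def)
  have "C \<ge> 0" using d by (simp add: C_def)
  have sum_bound: "norm (\<Sum>k<K. h k t) \<le> M t" if "t > 0" for K t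
  proof -
    have "norm (\<Sum>k<K. h k t) \<le> (\<Sum>k<K. C * real (Suc k) powr (-3/2) * ln_majorant t)"
      by (intro sum_norm_le h_bound that)
    also have "\<dots> = C * (\<Sum>k<K. real (Suc k) powr (-3/2)) * ln_majorant t"
      by (simp add: sum_distrib_left sum_distrib_right)
    also have "\<dots> \<le> M t"
      unfolding M_def
      by (intro mult_right_mono mult_left_mono sum_le_suminf summable majorant_nonneg \<open>C \<ge> 0\<close>) auto
    finally show ?thesis .
  qed
  have h_sums: "(\<lambda>k. h k t) sums g t" if "t > 0" for t
  proof -
    define u where "u = of_nat p * of_real t - \<i> * of_real \<theta>"
    have "Re u > 0" using that p by (simp add: u_def)
    hence "(\<lambda>k. inverse ((u - 2 * of_real pi * \<i> * of_nat k) ^ Suc m) +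
                inverse ((u + 2 * of_real pi * \<i> * of_nat (Suc k)) ^ Suc m))
            sums (polylog (- of_nat m) (exp (- u)) / fact m)"
      using m by (intro lipschitz_summation) auto
    hence "(\<lambda>k. fact m * of_real (ln t) * (inverse ((u - 2 * of_real pi * \<i> * of_nat k) ^ Suc m) +
                inverse ((u + 2 * of_real pi * \<i> * of_nat (Suc k)) ^ Suc m)))
            sums (fact m * of_real (ln t) * (polylog (- of_nat m) (exp (- u)) / fact m))"
      by (rule sums_mult)
    also have "(\<lambda>k. fact m * of_real (ln t) * (inverse ((u - 2 * of_real pi * \<i> * of_nat k) ^ Suc m) +
                inverse ((u + 2 * of_real pi * \<i> * of_nat (Suc k)) ^ Suc m))) = (\<lambda>k. h k t)"
    proof
      fix k
      have "u - 2 * of_real pi * \<i> * of_nat k = of_nat p * (of_real t + c k)"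
           "u + 2 * of_real pi * \<i> * of_nat (Suc k) = of_nat p * (of_real t + c' k)"
        using p by (simp_all add: u_def c_def c'_def field_simps)
      thus "fact m * of_real (ln t) * (inverse ((u - 2 * of_real pi * \<i> * of_nat k) ^ Suc m) +
                inverse ((u + 2 * of_real pi * \<i> * of_nat (Suc k)) ^ Suc m)) = h k t"
        unfolding h_def by (simp only: power_mult_distrib inverse_mult_distrib)
          (simp only: divide_inverse ring_distribs mult_ac)
    qed
    also have "fact m * of_real (ln t) * (polylog (- of_nat m) (exp (- u)) / fact m) = g t"
      by (simp add: g_def u_def)
    finally show ?thesis .
  qed
  have H_int: "((\<lambda>t. \<Sum>k<K. h k t) has_integral
                  (\<Sum>k<K. fact m / of_nat p ^ Suc m * (J (c k) + J (c' k)))) {0<..}" for K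
    by (intro has_integral_sum h_int) auto
  have lim: "(\<lambda>K. \<Sum>k<K. h k t) \<longlonglongrightarrow> g t" if "t \<in> {0<..}" for t
    using h_sums[of t] that by (simp add: sums_def)
  have bound: "norm (\<Sum>k<K. h k t) \<le> M t" if "t \<in> {0<..}" for K t
    using sum_bound[of t] that by simp
  \<comment> \<open>All partial sums lie below the one integrable function \<open>M\<close>, so sum
    and integral may be exchanged.\<close>
  note dom = dominated_convergence[OF has_integral_integrable[OF H_int] M_int bound lim]
  show "(\<lambda>k. fact m / of_nat p ^ Suc m * (J (c k) + J (c' k))) sums integral {0<..} g"
    using dom(2) by (simp add: sums_def integral_unique[OF H_int])
  \<comment> \<open>The bound passes to the limit and gives absolute integrability, which the change
    of variables relies on.\<close>
  have "norm (g t) \<le> M t" if "t \<in> {0<..}" for t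
    by (rule LIMSEQ_le_const2[OF tendsto_norm[OF lim[OF that]]]) (use bound[OF that] in auto)
  thus "g absolutely_integrable_on {0<..}"
    using dom(1) M_int by (rule absolutely_integrable_integrable_bound)
qed

text \<open>Under \<open>x = exp (- t)\<close> the Jacobian has modulus \<open>x\<close> and cancels
  the \<open>1 / x\<close>, while \<open>ln (1 / x)\<close> becomes \<open>t\<close>.\<close>

theorem polylog_ln_ln_integral:
  fixes \<theta> :: real and m p :: nat
  defines "c \<equiv> \<lambda>k. - \<i> * of_real ((\<theta> + 2 * pi * real k) / real p)"
      and "c' \<equiv> \<lambda>k. \<i> * of_real ((2 * pi * real (Suc k) - \<theta>) / real p)"
      and "J \<equiv> \<lambda>c. (Ln c - harm (m - 1)) / (of_nat m * c ^ m)"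
      and "f \<equiv> \<lambda>x. polylog (- of_nat m) (cis \<theta> * of_real x ^ p) / of_real x * of_real (ln (ln (1 / x)))"
  assumes \<theta>: "0 < \<theta>" "\<theta> < 2 * pi" and m: "m \<ge> 2" and p: "p > 0"
  shows "f integrable_on {0<..<1}"
    and "(\<lambda>k. fact m / of_nat p ^ Suc m * (J (c k) + J (c' k))) sums integral {0<..<1} f"
proof -
  define e where "e = (\<lambda>t::real. exp (- t))"
  define g where "g = (\<lambda>t. of_real (ln t) *
      polylog (- of_nat m) (exp (- (of_nat p * of_real t - \<i> * of_real \<theta>))))"
  have g: "g absolutely_integrable_on {0<..}"
    "(\<lambda>k. fact m / of_nat p ^ Suc m * (J (c k) + J (c' k))) sums integral {0<..} g"
    unfolding g_def J_def c_def c'_def by (rule polylog_ln_integral_Ioi[OF \<theta> m p])+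
  have image: "e ` {0<..} = {0<..<1}"
  proof (intro equalityI subsetI)
    fix x :: real assume x: "x \<in> {0<..<1}"
    hence "x = e (- ln x)" "- ln x > 0" by (simp_all add: e_def)
    thus "x \<in> e ` {0<..}" by auto
  qed (auto simp: e_def)
  have sub: "\<bar>- e t\<bar> *\<^sub>R f (e t) = g t" for t
  proof -
    have "cis \<theta> * of_real (e t) ^ p = exp (- (of_nat p * of_real t - \<i> * of_real \<theta>))"
      by (simp add: cis_conv_exp e_def exp_diff exp_minus exp_of_nat_mult field_simps flip: exp_of_real exp_of_nat_mult)
    moreover have "ln (1 / e t) = t" by (simp add: e_def ln_div)
    ultimately show ?thesis by (simp add: f_def g_def scaleR_conv_of_real e_def)
  qed
  have "f absolutely_integrable_on e ` {0<..} \<and> integral (e ` {0<..}) f = integral {0<..} g"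
  proof (subst has_absolute_integral_change_of_variables_real [symmetric])
    show "(e has_field_derivative - e t) (at t within {0<..})" for t
      unfolding e_def by (auto intro!: derivative_eq_intros)
    show "inj_on e {0<..}" by (auto simp: inj_on_def e_def)
    show "(\<lambda>t. \<bar>- e t\<bar> *\<^sub>R f (e t)) absolutely_integrable_on {0<..} \<and>
          integral {0<..} (\<lambda>t. \<bar>- e t\<bar> *\<^sub>R f (e t)) = integral {0<..} g"
      unfolding sub using g(1) by simp
  qed auto
  thus "f integrable_on {0<..<1}"
    and "(\<lambda>k. fact m / of_nat p ^ Suc m * (J (c k) + J (c' k))) sums integral {0<..<1} f"
    unfolding image using g(2) set_lebesgue_integral_eq_integral(1) by auto
qed

section \<open>The Dirichlet series of \<open>\<beta>\<close> and the odd part of that of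
  \<open>\<zeta>\<close>\<close>

text \<open>A real witness \<open>B\<close> is provided because the series will be compared with one
  of imaginary parts. For \<open>m \<ge> 2\<close> convergence is absolute.\<close>

lemma dirichlet_beta_of_nat_sums:
  assumes "m \<ge> 2"
  obtains B where "dirichlet_beta (of_nat m) = of_real B"
    and "(\<lambda>r. (-1) ^ r / real (2 * r + 1) ^ m) sums B"
proof -
  have "summable (\<lambda>r. inverse (real (Suc r) ^ m))"
    using inverse_power_summable[OF assms, where 'a = real] by (subst summable_Suc_iff)
  hence "summable (\<lambda>r. (-1) ^ r / real (2 * r + 1) ^ m)"
  proof (rule summable_comparison_test'[where N = 0])
    fix r :: nat
    have "real (Suc r) ^ m \<le> real (2 * r + 1) ^ m" by (intro power_mono) auto
    thus "norm ((-1) ^ r / real (2 * r + 1) ^ m) \<le> inverse (real (Suc r) ^ m)"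
      by (simp add: norm_divide norm_power divide_simps del: of_nat_Suc of_nat_mult of_nat_add)
  qed
  then obtain B where B: "(\<lambda>r. (-1) ^ r / real (2 * r + 1) ^ m) sums B"
    by (auto simp: summable_def)
  have "(-1) ^ r * of_nat (2 * r + 1) powr (- of_nat m) =
          complex_of_real ((-1) ^ r / real (2 * r + 1) ^ m)" for r
    by (subst powr_minus, subst powr_complexpow)
       (simp_all add: divide_inverse complex_eq_iff del: of_nat_mult of_nat_add)
  hence "dirichlet_beta (of_nat m) = (\<Sum>r. of_real ((-1) ^ r / real (2 * r + 1) ^ m))"
    unfolding dirichlet_beta_def by presburger
  also have "\<dots> = of_real B"
    using sums_of_real[OF B, where 'a = complex] by (rule sums_unique [symmetric])
  finally show ?thesis using that B by blast
qed

lemma dirichlet_beta_grouped_sums: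
  assumes "(\<lambda>r. (-1) ^ r / real (2 * r + 1) ^ m) sums B"
  shows "(\<lambda>k. 1 / real (4 * k + 1) ^ m - 1 / real (4 * k + 3) ^ m) sums B"
proof -
  have set: "{k * 2..<k * 2 + 2} = {2 * k, 2 * k + 1}" for k :: nat by auto
  show ?thesis using sums_group[OF assms, of 2] unfolding set by (simp add: algebra_simps)
qed

text \<open>The terms with even denominators form \<open>1 / 2 ^ m\<close> times the whole series;
  subtracting them leaves the odd ones.\<close>

lemma riemann_zeta_of_nat_sums_odd:
  assumes "m \<ge> 2"
  shows "(\<lambda>k. 1 / of_nat (2 * k + 1) ^ m) sums ((1 - 1 / 2 ^ m) * riemann_zeta (of_nat m))"
proof -
  define f where "f = (\<lambda>r. 1 / complex_of_nat (Suc r) ^ m)"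
  have "summable (\<lambda>r. inverse (complex_of_nat (Suc r) ^ m))"
    using inverse_power_summable[OF assms, where 'a = complex] by (subst summable_Suc_iff)
  moreover have "of_nat (Suc r) powr (- of_nat m) = f r" for r
    unfolding f_def by (subst powr_minus, subst powr_complexpow) (simp_all add: inverse_eq_divide del: of_nat_Suc)
  hence "riemann_zeta (of_nat m) = suminf f"
    unfolding riemann_zeta_def by presburger
  ultimately have f: "f sums riemann_zeta (of_nat m)"
    by (simp add: f_def inverse_eq_divide summable_sums)
  have set: "{k * 2..<k * 2 + 2} = {2 * k, 2 * k + 1}" for k :: nat by auto
  have "(\<lambda>k. f (2 * k) + f (2 * k + 1)) sums riemann_zeta (of_nat m)"
    using sums_group[OF f, of 2] unfolding set by simp
  moreover have "(\<lambda>k. 1 / 2 ^ m * f k) sums (1 / 2 ^ m * riemann_zeta (of_nat m))"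
    by (intro sums_mult f)
  \<comment> \<open>Index \<open>r\<close> stands for the denominator \<open>r + 1\<close>, so the
    odd indices carry the even denominators.\<close>
  moreover have "1 / 2 ^ m * f k = f (2 * k + 1)" for k
  proof -
    have "of_nat (Suc (2 * k + 1)) = (2 * of_nat (Suc k) :: complex)" by simp
    thus ?thesis unfolding f_def by (simp only: power_mult_distrib) simp
  qed
  ultimately have "(\<lambda>k. f (2 * k) + f (2 * k + 1) - f (2 * k + 1)) sums
                     (riemann_zeta (of_nat m) - 1 / 2 ^ m * riemann_zeta (of_nat m))"
    by (intro sums_diff) auto
  thus ?thesis by (simp add: f_def algebra_simps)
qed

section \<open>Terms with \<open>c\<close> on the imaginary axis\<close>

lemma Ln_ii_times_of_real:
  assumes "x > 0"
  shows "Ln (\<i> * of_real x) = of_real (ln x) + \<i> * of_real (pi / 2)"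
    and "Ln (- \<i> * of_real x) = of_real (ln x) - \<i> * of_real (pi / 2)"
  using Ln_times_of_real[OF assms, of \<i>] Ln_times_of_real[OF assms, of "- \<i>"]
  by (simp_all add: mult.commute Ln_of_real assms)

text \<open>An even power of a purely imaginary number is real. Hence \<open>ln x\<close>,
  \<open>ln y\<close> and the harmonic number drop out of the imaginary part, and the arguments of
  the logarithms remain.\<close>

lemma Im_kernel_sum_even:
  fixes x y :: real
  assumes "x > 0" "y > 0"
  shows "Im ((Ln (- \<i> * of_real x) - harm l) / (of_nat (2 * n) * (- \<i> * of_real x) ^ (2 * n)) +
             (Ln (\<i> * of_real y) - harm l) / (of_nat (2 * n) * (\<i> * of_real y) ^ (2 * n))) =
         - ((-1) ^ n) * pi / (4 * real n) * (1 / x ^ (2 * n) - 1 / y ^ (2 * n))"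
proof -
  have ii_power: "(- \<i>) ^ (2 * n) = (-1) ^ n" "\<i> ^ (2 * n) = (-1) ^ n"
    by (simp_all add: power_mult)
  have den: "of_nat (2 * n) * (- \<i> * complex_of_real x) ^ (2 * n) = of_real (2 * real n * (-1) ^ n * x ^ (2 * n))"
            "of_nat (2 * n) * (\<i> * complex_of_real x) ^ (2 * n) = of_real (2 * real n * (-1) ^ n * x ^ (2 * n))" for x
    unfolding power_mult_distrib ii_power by simp_all
  have "Im (harm l) = 0" by (metis Im_complex_of_real of_real_harm)
  hence "Im ((of_real L - \<i> * of_real (pi / 2) - harm l) / of_real d) = - (pi / 2) / d"
        "Im ((of_real L + \<i> * of_real (pi / 2) - harm l) / of_real d) = (pi / 2) / d" for L d
    by simp_all
  moreover have "- (pi / 2) / (2 * real n * (-1) ^ n * a) + (pi / 2) / (2 * real n * (-1) ^ n * b) =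
                   - ((-1) ^ n) * pi / (4 * real n) * (1 / a - 1 / b)" for a b
    by (cases "even n") (simp_all add: right_diff_distrib)
  ultimately show ?thesis
    unfolding den Ln_ii_times_of_real[OF assms(1)] Ln_ii_times_of_real[OF assms(2)]
    by (simp only: plus_complex.sel)
qed

text \<open>The two denominators are opposite, so \<open>ln x\<close> and the harmonic number
  cancel, whereas the opposite arguments \<open>\<plusminus>pi / 2\<close> reinforce each
  other.\<close>

lemma kernel_sum_odd:
  fixes x :: real
  assumes "x > 0"
  shows "(Ln (- \<i> * of_real x) - harm l) / (of_nat (2 * n + 1) * (- \<i> * of_real x) ^ (2 * n + 1)) +
         (Ln (\<i> * of_real x) - harm l) / (of_nat (2 * n + 1) * (\<i> * of_real x) ^ (2 * n + 1)) =
         of_real ((-1) ^ n * pi / (real (2 * n + 1) * x ^ (2 * n + 1)))"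
proof -
  have ii_power: "(- \<i>) ^ (2 * n + 1) = (-1) ^ n * - \<i>" "\<i> ^ (2 * n + 1) = (-1) ^ n * \<i>"
    by (simp_all add: power_mult)
  define D where "D = complex_of_real (real (2 * n + 1) * ((-1) ^ n * x ^ (2 * n + 1)))"
  have den: "of_nat (2 * n + 1) * (- \<i> * complex_of_real x) ^ (2 * n + 1) = - \<i> * D"
            "of_nat (2 * n + 1) * (\<i> * complex_of_real x) ^ (2 * n + 1) = \<i> * D"
    unfolding D_def power_mult_distrib ii_power by (simp_all add: mult_ac)
  have "real (2 * n + 1) * ((-1) ^ n * x ^ (2 * n + 1)) \<noteq> 0" using assms by simp
  hence "D \<noteq> 0" unfolding D_def of_real_eq_0_iff .
  hence "(Ln (- \<i> * of_real x) - harm l) / (- \<i> * D) + (Ln (\<i> * of_real x) - harm l) / (\<i> * D) =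
          of_real pi / D"
    unfolding Ln_ii_times_of_real[OF assms] by (simp add: field_simps)
  also have "\<dots> = of_real ((-1) ^ n * pi / (real (2 * n + 1) * x ^ (2 * n + 1)))"
    by (cases "even n") (simp_all add: D_def)
  finally show ?thesis unfolding den .
qed

section \<open>The two evaluations\<close>

theorem proposition6p3:
  fixes n :: nat
  assumes "n \<ge> 1"
  shows "(((\<lambda>x::real. complex_of_real
             (Im (polylog (- (2 * of_nat n)) (\<i> * of_real x)) / x * ln (ln (1 / x))))
           has_integral
             ((-1) ^ (n - 1) * 2 ^ (2 * n - 1) * fact (2 * n - 1)
               * (dirichlet_beta (2 * of_nat n) / of_real pi ^ (2 * n - 1)))) {0<..<1}) \<and>
         (((\<lambda>x::real. polylog (- (2 * of_nat n) - 1) (- (of_real x ^ 2)) / of_real x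
             * complex_of_real (ln (ln (1 / x))))
           has_integral
             ((-1) ^ n * ((2 ^ (2 * n + 1) - 1) * fact (2 * n) / 2 ^ (2 * n + 2))
               * (riemann_zeta (2 * of_nat n + 1) / of_real pi ^ (2 * n)))) {0<..<1})"
proof
  define f where "f = (\<lambda>x. polylog (- of_nat (2 * n)) (cis (pi / 2) * of_real x ^ 1) / of_real x
                           * of_real (ln (ln (1 / x))))"
  define I where "I = integral {0<..<1} f"
  define K where "K = (-1) ^ (n - 1) * 2 ^ (2 * n - 1) * fact (2 * n - 1) / pi ^ (2 * n - 1)"
  have m: "2 * n \<ge> 2" using assms by simp
  obtain B where B: "dirichlet_beta (of_nat (2 * n)) = of_real B"
    "(\<lambda>r. (-1) ^ r / real (2 * r + 1) ^ (2 * n)) sums B"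
    using dirichlet_beta_of_nat_sums[OF m] .
  have \<theta>: "0 < pi / 2" "pi / 2 < 2 * pi" "(1::nat) > 0" by simp_all
  note f = polylog_ln_ln_integral[OF \<theta>(1,2) m \<theta>(3), folded f_def I_def]
  \<comment> \<open>The moduli are \<open>pi / 2\<close> times the numbers congruent to 1 (from
    \<open>c\<close>) and to 3 (from \<open>c'\<close>) modulo 4, which is the series of
    \<open>\<beta>\<close> grouped in pairs.\<close>
  have arg: "(pi / 2 + 2 * pi * real k) / real 1 = pi / 2 * real (4 * k + 1)"
            "(2 * pi * real (Suc k) - pi / 2) / real 1 = pi / 2 * real (4 * k + 3)" for k
    by (simp_all add: field_simps)
  have pos: "(pi / 2 + 2 * pi * real k) / real 1 > 0" "(2 * pi * real (Suc k) - pi / 2) / real 1 > 0" for k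
    unfolding arg by simp_all
  have Im_fact: "Im (fact (2 * n) / of_nat 1 ^ Suc (2 * n) * z) = fact (2 * n) * Im z" for z
  proof -
    have "fact (2 * n) / of_nat 1 ^ Suc (2 * n) = complex_of_real (fact (2 * n))" by simp
    moreover have "Im (of_real r * z) = r * Im z" for r by simp
    ultimately show ?thesis by presburger
  qed
  have K: "fact (2 * n) * (- ((-1) ^ n) * pi / (4 * real n) / (pi / 2) ^ (2 * n)) = K"
  proof -
    \<comment> \<open>Replaces the truncated difference by a successor equation, so that
      \<open>fact\<close> and the powers unfold.\<close>
    define N where "N = 2 * n - 1"
    have N: "2 * n = Suc N" using assms by (simp add: N_def)
    have "fact (2 * n) = 2 * real n * fact N"
      unfolding N fact_Suc using N by (metis of_nat_mult of_nat_numeral)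
    moreover have "(pi / 2) ^ (2 * n) = pi * pi ^ N / (2 * 2 ^ N)"
      by (simp add: N power_divide)
    moreover have "- ((-1) ^ n) = (-1 :: real) ^ (n - 1)"
      using assms power_Suc[of "-1 :: real" "n - 1"] by simp
    ultimately show ?thesis
      using assms unfolding K_def N_def [symmetric] by (simp only:) (simp add: divide_simps)
  qed
  have coeff: "fact (2 * n) * (- ((-1) ^ n) * pi / (4 * real n) *
             (1 / ((pi / 2 + 2 * pi * real k) / real 1) ^ (2 * n) -
              1 / ((2 * pi * real (Suc k) - pi / 2) / real 1) ^ (2 * n))) =
             K * (1 / real (4 * k + 1) ^ (2 * n) - 1 / real (4 * k + 3) ^ (2 * n))" for k
  proof -
    have scale: "A * (1 / (P * a) ^ M - 1 / (P * b) ^ M) = A / P ^ M * (1 / a ^ M - 1 / b ^ M)"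
      for A P a b :: real and M
      by (simp add: power_mult_distrib right_diff_distrib)
    show ?thesis unfolding arg scale K [symmetric] by (simp only: mult.assoc)
  qed
  have "(\<lambda>k. K * (1 / real (4 * k + 1) ^ (2 * n) - 1 / real (4 * k + 3) ^ (2 * n))) sums Im I"
    using sums_Im[OF f(2)] unfolding Im_fact Im_kernel_sum_even[OF pos] coeff .
  moreover have "(\<lambda>k. K * (1 / real (4 * k + 1) ^ (2 * n) - 1 / real (4 * k + 3) ^ (2 * n))) sums (K * B)"
    by (intro sums_mult dirichlet_beta_grouped_sums B)
  ultimately have "Im I = K * B" by (rule sums_unique2)
  moreover have "((\<lambda>x. complex_of_real (Im (f x))) has_integral of_real (Im I)) {0<..<1}"
    using has_integral_linear[OF has_integral_linear[OF integrable_integral[OF f(1)] bounded_linear_Im]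
            bounded_linear_of_real] by (simp add: o_def I_def)
  ultimately have "((\<lambda>x. complex_of_real (Im (f x))) has_integral of_real (K * B)) {0<..<1}" by simp
  also have "(\<lambda>x. complex_of_real (Im (f x))) = (\<lambda>x. complex_of_real
             (Im (polylog (- (2 * of_nat n)) (\<i> * of_real x)) / x * ln (ln (1 / x))))"
    by (simp add: f_def)
  also have "complex_of_real (K * B) = (-1) ^ (n - 1) * 2 ^ (2 * n - 1) * fact (2 * n - 1)
               * (dirichlet_beta (2 * of_nat n) / of_real pi ^ (2 * n - 1))"
    using B(1) by (simp add: K_def)
  finally show "((\<lambda>x::real. complex_of_real
             (Im (polylog (- (2 * of_nat n)) (\<i> * of_real x)) / x * ln (ln (1 / x))))
           has_integral
             ((-1) ^ (n - 1) * 2 ^ (2 * n - 1) * fact (2 * n - 1)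
               * (dirichlet_beta (2 * of_nat n) / of_real pi ^ (2 * n - 1)))) {0<..<1}" .
next
  define f where "f = (\<lambda>x. polylog (- of_nat (2 * n + 1)) (cis pi * of_real x ^ 2) / of_real x
                           * of_real (ln (ln (1 / x))))"
  define I where "I = integral {0<..<1} f"
  define K where "K = (-1) ^ n * fact (2 * n) / (2 * complex_of_real pi ^ (2 * n))"
  have m: "2 * n + 1 \<ge> 2" using assms by simp
  have \<theta>: "0 < pi" "pi < 2 * pi" "(2::nat) > 0" by simp_all
  note f = polylog_ln_ln_integral[OF \<theta>(1,2) m \<theta>(3), folded f_def I_def]
  \<comment> \<open>For \<open>\<theta> = pi\<close> the numbers \<open>c k\<close> and
    \<open>c' k\<close> are conjugate, so a single modulus, an odd multiple of
    \<open>pi / 2\<close>, serves both.\<close>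
  have arg: "(pi + 2 * pi * real k) / real 2 = pi / 2 * real (2 * k + 1)"
            "(2 * pi * real (Suc k) - pi) / real 2 = pi / 2 * real (2 * k + 1)" for k
    by (simp_all add: field_simps)
  have pos: "pi / 2 * real (2 * k + 1) > 0" for k by simp
  have coeff: "fact (2 * n + 1) / of_nat 2 ^ Suc (2 * n + 1) *
       complex_of_real ((-1) ^ n * pi / (real (2 * n + 1) * (pi / 2 * real (2 * k + 1)) ^ (2 * n + 1))) =
       K * (1 / of_nat (2 * k + 1) ^ (2 * n + 1))" for k
  proof -
    have "fact (2 * n + 1) = complex_of_real (real (2 * n + 1)) * fact (2 * n)" by simp
    moreover have "1 + complex_of_nat (2 * n) \<noteq> 0"
      using of_nat_neq_0[of "2 * n", where 'a = complex] by (simp del: of_nat_mult)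
    moreover have "complex_of_real (real (2 * k + 1)) = of_nat (2 * k + 1)"
      by (rule of_real_of_nat_eq)
    ultimately show ?thesis
      by (simp add: K_def divide_simps del: of_nat_mult)
  qed
  have "(\<lambda>k. K * (1 / of_nat (2 * k + 1) ^ (2 * n + 1))) sums I"
    using f(2) unfolding arg kernel_sum_odd[OF pos] coeff .
  moreover have "(\<lambda>k. K * (1 / of_nat (2 * k + 1) ^ (2 * n + 1))) sums
                   (K * ((1 - 1 / 2 ^ (2 * n + 1)) * riemann_zeta (of_nat (2 * n + 1))))"
    by (intro sums_mult riemann_zeta_of_nat_sums_odd m)
  ultimately have "I = K * ((1 - 1 / 2 ^ (2 * n + 1)) * riemann_zeta (of_nat (2 * n + 1)))"
    by (rule sums_unique2)
  also have "\<dots> = (-1) ^ n * ((2 ^ (2 * n + 1) - 1) * fact (2 * n) / 2 ^ (2 * n + 2))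
               * (riemann_zeta (2 * of_nat n + 1) / of_real pi ^ (2 * n))"
  proof -
    have 1: "1 - 1 / 2 ^ (2 * n + 1) = (2 ^ (2 * n + 1) - 1) / (2 ^ (2 * n + 1) :: complex)"
      by (simp add: diff_divide_distrib)
    have "s * F / (2 * P) * (Y / Q * Z) = s * (Y * F / (2 * Q)) * (Z / P)"
      for s F P Y Q Z :: complex by (simp add: mult_ac)
    moreover have 2: "2 ^ (2 * n + 2) = (2 * 2 ^ (2 * n + 1) :: complex)" by simp
    moreover have 3: "complex_of_nat (2 * n + 1) = 2 * of_nat n + 1" by simp
    ultimately show ?thesis unfolding K_def 1 2 3 by blast
  qed
  finally have I: "I = \<dots>" .
  have "(f has_integral I) {0<..<1}" using f(1) by (simp add: I_def integrable_integral)
  also have "f = (\<lambda>x::real. polylog (- (2 * of_nat n) - 1) (- (of_real x ^ 2)) / of_real x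
             * complex_of_real (ln (ln (1 / x))))"
  proof -
    have arg: "- complex_of_nat (2 * n + 1) = - (2 * of_nat n) - 1" by simp
    show ?thesis unfolding f_def cis_pi arg by simp
  qed
  finally show "((\<lambda>x::real. polylog (- (2 * of_nat n) - 1) (- (of_real x ^ 2)) / of_real x
             * complex_of_real (ln (ln (1 / x))))
           has_integral
             ((-1) ^ n * ((2 ^ (2 * n + 1) - 1) * fact (2 * n) / 2 ^ (2 * n + 2))
               * (riemann_zeta (2 * of_nat n + 1) / of_real pi ^ (2 * n)))) {0<..<1}"
    unfolding I .
qed

end
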